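(* For every co-prime pair $(m,n)$ of nonnegative integers with $m\ge1$: if $m>1$ and $\mathrm{Split}(m,n)=(a,b)+(c,d)$ then $Q_{m,n}=\frac1M[Q_{c,d},Q_{a,b}]$, and if $m=1$ then $Q_{1,n}=D_n$.
   Context: Work over $\mathbb{Q}(q,t)$; $\Lambda$ is the algebra of symmetric functions in $X=x_1+x_2+\cdots$, with plethystic notation ($p_k[E]$ = $E$ with all variables including $q,t$ raised to the $k$-th power) and $\Omega[E]=\exp(\sum_{k\ge1}p_k[E]/k)$. $M=(1-t)(1-q)$. For $k\in\mathbb{Z}$, $D_kF[X]=F[X+\tfrac Mz]\Omega[-zX]|_{z^k}$ (coefficient of $z^k$). $\underline{e}_1$ is multiplication by $e_1[X]$; $[A,B]=AB-BA$. Split: for co-prime $m,n>1$, let $(a,b)$ be the unique pair with $1\le a\le m-1$, $1\le b\le n-1$, $mb+1=na$, and set $\mathrm{Split}(m,n)=(a,b)+(c,d)$ with $(c,d)=(m-a,n-b)$; also $\mathrm{Split}(1,n)=(1,n-1)+(0,1)$ for $n\ge1$ and $\mathrm{Split}(m,1)=(1,0)+(m-1,1)$ for $m\ge1$. The operators $Q_{m,n}$, for co-prime nonnegative pairs $(m,n)\ne(0,0)$, are defined by $Q_{1,0}=D_0$, $Q_{0,1}=-\underline{e}_1$, and recursively $Q_{m,n}=\frac1M[Q_{c,d},Q_{a,b}]$ whenever $m,n\ge1$ and $\mathrm{Split}(m,n)=(a,b)+(c,d)$. *)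

theory Defs
  imports
    "HOL-Computational_Algebra.Computational_Algebra"
    "HOL-Library.Poly_Mapping"
    "HOL-Number_Theory.Cong"
begin

unbundle fps_syntax

section \<open>The algebra of symmetric functions\<close>

text \<open>
  A monomial in the variables \<open>x\<^sub>0, x\<^sub>1, x\<^sub>2, \<dots>\<close> is the multiset of the indices of its factors,
  so monomials multiply by multiset sum, have degree \<^const>\<open>size\<close>, and the \<open>k\<close>-th power of a
  monomial is \<^const>\<open>repeat_mset\<close> \<open>k\<close>. A symmetric function is a formal power series (a function
  from monomials to coefficients) of bounded degree that is invariant under all permutations
  of the variables.
\<close>

typedef (overloaded) 'a symfun =
  "{f :: nat multiset \<Rightarrow> 'a::zero.
      (\<exists>d. \<forall>\<mu>. size \<mu> > d \<longrightarrow> f \<mu> = 0) \<and> (\<forall>\<pi> \<mu>. bij \<pi> \<longrightarrow> f (image_mset \<pi> \<mu>) = f \<mu>)}"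
  morphisms scoeff Abs_symfun
  by (rule exI[of _ "\<lambda>_. 0"]) simp

setup_lifting type_definition_symfun

lemma symfun_eqI: "(\<And>\<mu>. scoeff f \<mu> = scoeff g \<mu>) \<Longrightarrow> f = g"
  by (metis ext scoeff_inject)

lemma finite_mset_splits: "finite {(\<alpha>, \<beta>). \<alpha> + \<beta> = (\<mu> :: 'b multiset)}"
proof (rule finite_subset)
  have *: "finite {\<alpha>. \<alpha> \<subseteq># \<mu>}"
  proof (induction \<mu>)
    case (add x \<mu>)
    have "{\<alpha>. \<alpha> \<subseteq># add_mset x \<mu>} \<subseteq> {\<alpha>. \<alpha> \<subseteq># \<mu>} \<union> add_mset x ` {\<alpha>. \<alpha> \<subseteq># \<mu>}"
    proof
      fix \<alpha> assume "\<alpha> \<in> {\<alpha>. \<alpha> \<subseteq># add_mset x \<mu>}"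
      hence a: "\<alpha> \<subseteq># add_mset x \<mu>" by simp
      show "\<alpha> \<in> {\<alpha>. \<alpha> \<subseteq># \<mu>} \<union> add_mset x ` {\<alpha>. \<alpha> \<subseteq># \<mu>}"
      proof (cases "x \<in># \<alpha>")
        case True
        then obtain \<beta> where "\<alpha> = add_mset x \<beta>" by (metis multi_member_split)
        with a show ?thesis by auto
      next
        case False
        with a have "\<alpha> \<subseteq># \<mu>"
          by (metis add_mset_remove_trivial diff_single_trivial subset_eq_diff_conv add_mset_add_single)
        thus ?thesis by simp
      qed
    qed
    thus ?case using add by (meson finite_UnI finite_imageI finite_subset)
  qed simp
  show "{(\<alpha>, \<beta>). \<alpha> + \<beta> = \<mu>} \<subseteq> {\<alpha>. \<alpha> \<subseteq># \<mu>} \<times> {\<alpha>. \<alpha> \<subseteq># \<mu>}"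
    by auto
  show "finite ({\<alpha>. \<alpha> \<subseteq># \<mu>} \<times> {\<alpha>. \<alpha> \<subseteq># \<mu>})" using * by simp
qed

lemma mset_splits_image:
  assumes "bij \<pi>"
  shows "bij_betw (map_prod (image_mset \<pi>) (image_mset \<pi>))
           {(\<alpha>, \<beta>). \<alpha> + \<beta> = \<mu>} {(\<alpha>, \<beta>). \<alpha> + \<beta> = image_mset \<pi> \<mu>}"
proof (rule bij_betw_byWitness[where f' = "map_prod (image_mset (inv \<pi>)) (image_mset (inv \<pi>))"])
  have l: "image_mset (inv \<pi>) (image_mset \<pi> \<alpha>) = \<alpha>" for \<alpha>
    using assms by (simp add: multiset.map_comp bij_is_inj)
  have r: "image_mset \<pi> (image_mset (inv \<pi>) \<alpha>) = \<alpha>" for \<alpha>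
    using assms by (simp add: multiset.map_comp comp_def bij_is_surj surj_f_inv_f)
  show "\<forall>a\<in>{(\<alpha>, \<beta>). \<alpha> + \<beta> = \<mu>}. map_prod (image_mset (inv \<pi>)) (image_mset (inv \<pi>))
          (map_prod (image_mset \<pi>) (image_mset \<pi>) a) = a"
    using l by auto
  show "\<forall>a\<in>{(\<alpha>, \<beta>). \<alpha> + \<beta> = image_mset \<pi> \<mu>}. map_prod (image_mset \<pi>) (image_mset \<pi>)
          (map_prod (image_mset (inv \<pi>)) (image_mset (inv \<pi>)) a) = a"
    using r by auto
  show "map_prod (image_mset \<pi>) (image_mset \<pi>) ` {(\<alpha>, \<beta>). \<alpha> + \<beta> = \<mu>}
          \<subseteq> {(\<alpha>, \<beta>). \<alpha> + \<beta> = image_mset \<pi> \<mu>}"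
    by auto
  show "map_prod (image_mset (inv \<pi>)) (image_mset (inv \<pi>)) ` {(\<alpha>, \<beta>). \<alpha> + \<beta> = image_mset \<pi> \<mu>}
          \<subseteq> {(\<alpha>, \<beta>). \<alpha> + \<beta> = \<mu>}"
    using l by (auto simp flip: image_mset_union)
qed

instantiation symfun :: (comm_ring_1) comm_ring_1
begin

lift_definition zero_symfun :: "'a symfun" is "\<lambda>_. 0" by simp

lift_definition one_symfun :: "'a symfun" is "\<lambda>\<mu>. if \<mu> = {#} then 1 else 0"
  by (auto intro!: exI[of _ 0])

lift_definition plus_symfun :: "'a symfun \<Rightarrow> 'a symfun \<Rightarrow> 'a symfun" is "\<lambda>f g \<mu>. f \<mu> + g \<mu>"
proof -
  fix f g :: "nat multiset \<Rightarrow> 'a"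
  assume f: "(\<exists>d. \<forall>\<mu>. size \<mu> > d \<longrightarrow> f \<mu> = 0) \<and> (\<forall>\<pi> \<mu>. bij \<pi> \<longrightarrow> f (image_mset \<pi> \<mu>) = f \<mu>)"
    and g: "(\<exists>d. \<forall>\<mu>. size \<mu> > d \<longrightarrow> g \<mu> = 0) \<and> (\<forall>\<pi> \<mu>. bij \<pi> \<longrightarrow> g (image_mset \<pi> \<mu>) = g \<mu>)"
  then obtain d e where d: "\<forall>\<mu>. size \<mu> > d \<longrightarrow> f \<mu> = 0" and e: "\<forall>\<mu>. size \<mu> > e \<longrightarrow> g \<mu> = 0"
    by blast
  hence "\<forall>\<mu>. size \<mu> > max d e \<longrightarrow> f \<mu> + g \<mu> = 0" by simp
  thus "(\<exists>d. \<forall>\<mu>. size \<mu> > d \<longrightarrow> f \<mu> + g \<mu> = 0) \<and>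
        (\<forall>\<pi> \<mu>. bij \<pi> \<longrightarrow> f (image_mset \<pi> \<mu>) + g (image_mset \<pi> \<mu>) = f \<mu> + g \<mu>)"
    using f g by metis
qed

lift_definition uminus_symfun :: "'a symfun \<Rightarrow> 'a symfun" is "\<lambda>f \<mu>. - f \<mu>"
  by auto

definition minus_symfun :: "'a symfun \<Rightarrow> 'a symfun \<Rightarrow> 'a symfun" where
  "minus_symfun f g = f + (- g)"

lift_definition times_symfun :: "'a symfun \<Rightarrow> 'a symfun \<Rightarrow> 'a symfun" is
  "\<lambda>f g \<mu>. \<Sum>(\<alpha>, \<beta>) | \<alpha> + \<beta> = \<mu>. f \<alpha> * g \<beta>"
proof -
  fix f g :: "nat multiset \<Rightarrow> 'a"
  assume f: "(\<exists>d. \<forall>\<mu>. size \<mu> > d \<longrightarrow> f \<mu> = 0) \<and> (\<forall>\<pi> \<mu>. bij \<pi> \<longrightarrow> f (image_mset \<pi> \<mu>) = f \<mu>)"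
    and g: "(\<exists>d. \<forall>\<mu>. size \<mu> > d \<longrightarrow> g \<mu> = 0) \<and> (\<forall>\<pi> \<mu>. bij \<pi> \<longrightarrow> g (image_mset \<pi> \<mu>) = g \<mu>)"
  then obtain d e where d: "\<And>\<mu>. size \<mu> > d \<Longrightarrow> f \<mu> = 0" and e: "\<And>\<mu>. size \<mu> > e \<Longrightarrow> g \<mu> = 0"
    by blast
  have "(\<Sum>(\<alpha>, \<beta>) | \<alpha> + \<beta> = \<mu>. f \<alpha> * g \<beta>) = 0" if "size \<mu> > d + e" for \<mu>
  proof (rule sum.neutral, safe)
    fix \<alpha> \<beta> assume "\<mu> = \<alpha> + \<beta>"
    hence "size \<alpha> > d \<or> size \<beta> > e" using that by auto
    thus "f \<alpha> * g \<beta> = 0" using d e by auto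
  qed
  moreover have "(\<Sum>(\<alpha>, \<beta>) | \<alpha> + \<beta> = image_mset \<pi> \<mu>. f \<alpha> * g \<beta>) = (\<Sum>(\<alpha>, \<beta>) | \<alpha> + \<beta> = \<mu>. f \<alpha> * g \<beta>)"
    if "bij \<pi>" for \<pi> \<mu>
    by (subst sum.reindex_bij_betw[OF mset_splits_image[OF that], symmetric])
       (use f g that in \<open>auto intro!: sum.cong\<close>)
  ultimately show "(\<exists>d. \<forall>\<mu>. size \<mu> > d \<longrightarrow> (\<Sum>(\<alpha>, \<beta>) | \<alpha> + \<beta> = \<mu>. f \<alpha> * g \<beta>) = 0) \<and>
     (\<forall>\<pi> \<mu>. bij \<pi> \<longrightarrow> (\<Sum>(\<alpha>, \<beta>) | \<alpha> + \<beta> = image_mset \<pi> \<mu>. f \<alpha> * g \<beta>) = (\<Sum>(\<alpha>, \<beta>) | \<alpha> + \<beta> = \<mu>. f \<alpha> * g \<beta>))"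
    by blast
qed

instance
proof
  fix f g h :: "'a symfun"
  show "f + g + h = f + (g + h)" by transfer (simp add: add.assoc)
  show "f + g = g + f" by transfer (simp add: add.commute)
  show "0 + f = f" by transfer simp
  show "- f + f = 0" by transfer simp
  show "f - g = f + - g" by (rule minus_symfun_def)
  show "(0 :: 'a symfun) \<noteq> 1" by transfer (auto dest: fun_cong[of _ _ "{#}"])
  show "f * g = g * f"
  proof (rule symfun_eqI)
    fix \<mu> :: "nat multiset"
    have "bij_betw prod.swap {(\<alpha>, \<beta>). \<alpha> + \<beta> = \<mu>} {(\<alpha>, \<beta>). \<alpha> + \<beta> = \<mu>}"
      by (rule bij_betw_byWitness[where f' = prod.swap]) (auto simp: add.commute)
    from sum.reindex_bij_betw[OF this, of "\<lambda>(\<alpha>, \<beta>). scoeff f \<alpha> * scoeff g \<beta>", symmetric]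
    show "scoeff (f * g) \<mu> = scoeff (g * f) \<mu>"
      by (simp add: times_symfun.rep_eq case_prod_unfold mult.commute)
  qed
  show "(f + g) * h = f * h + g * h"
    by (rule symfun_eqI)
       (simp add: times_symfun.rep_eq plus_symfun.rep_eq case_prod_unfold distrib_right sum.distrib)
  show "1 * f = f"
  proof (rule symfun_eqI)
    fix \<mu> :: "nat multiset"
    have "scoeff (1 * f) \<mu> = (\<Sum>(\<alpha>, \<beta>)\<in>{({#}, \<mu>)}. scoeff 1 \<alpha> * scoeff f \<beta>)"
      unfolding times_symfun.rep_eq
      by (rule sum.mono_neutral_right) (auto simp: finite_mset_splits one_symfun.rep_eq split: if_splits)
    thus "scoeff (1 * f) \<mu> = scoeff f \<mu>" by (simp add: one_symfun.rep_eq)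
  qed
  show "f * g * h = f * (g * h)"
  proof (rule symfun_eqI)
    fix \<mu> :: "nat multiset"
    let ?L = "SIGMA p:{(\<alpha>, \<beta>). \<alpha> + \<beta> = \<mu>}. {(\<alpha>, \<beta>). \<alpha> + \<beta> = fst p}"
    let ?R = "SIGMA p:{(\<alpha>, \<beta>). \<alpha> + \<beta> = \<mu>}. {(\<alpha>, \<beta>). \<alpha> + \<beta> = snd p}"
    have "scoeff (f * g * h) \<mu> = (\<Sum>(p, r)\<in>?L. scoeff f (fst r) * scoeff g (snd r) * scoeff h (snd p))"
      by (simp add: times_symfun.rep_eq case_prod_unfold sum_distrib_right
          sum.Sigma[unfolded case_prod_unfold] finite_mset_splits[unfolded case_prod_unfold])
    also have "\<dots> = (\<Sum>(p, r)\<in>?R. scoeff f (fst p) * (scoeff g (fst r) * scoeff h (snd r)))"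
      by (rule sum.reindex_bij_witness[
            where i = "\<lambda>(p, r). ((fst p + fst r, snd r), (fst p, fst r))"
              and j = "\<lambda>(p, r). ((fst r, snd r + snd p), (snd r, snd p))"])
         (auto simp: ac_simps)
    also have "\<dots> = scoeff (f * (g * h)) \<mu>"
      by (simp add: times_symfun.rep_eq case_prod_unfold sum_distrib_left
          sum.Sigma[unfolded case_prod_unfold] finite_mset_splits[unfolded case_prod_unfold])
    finally show "scoeff (f * g * h) \<mu> = scoeff (f * (g * h)) \<mu>" .
  qed
qed

end

lift_definition scale :: "'a::comm_ring_1 \<Rightarrow> 'a symfun \<Rightarrow> 'a symfun" is "\<lambda>c f \<mu>. c * f \<mu>"
  by (metis mult_zero_right)

abbreviation const :: "'a::comm_ring_1 \<Rightarrow> 'a symfun" where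
  "const c \<equiv> scale c 1"

lift_definition elem_sym :: "nat \<Rightarrow> 'a::comm_ring_1 symfun" is
  "\<lambda>k \<mu>. if size \<mu> = k \<and> (\<forall>i. count \<mu> i \<le> 1) then 1 else 0"
proof -
  fix k :: nat
  have *: "(\<forall>i. count (image_mset \<pi> \<mu>) i \<le> 1) \<longleftrightarrow> (\<forall>i. count \<mu> i \<le> 1)" if "bij \<pi>" for \<pi> :: "nat \<Rightarrow> nat" and \<mu>
  proof -
    have "count (image_mset \<pi> \<mu>) (\<pi> i) = count \<mu> i" for i
      using bij_is_inj[OF that] by (induction \<mu>) (auto simp: inj_eq)
    thus ?thesis by (metis bij_pointE that)
  qed
  show "(\<exists>d. \<forall>\<mu>. size \<mu> > d \<longrightarrow>
           (if size \<mu> = k \<and> (\<forall>i. count \<mu> i \<le> 1) then 1 else 0 :: 'a) = 0) \<and>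
        (\<forall>(\<pi> :: nat \<Rightarrow> nat) \<mu>. bij \<pi> \<longrightarrow>
           (if size (image_mset \<pi> \<mu>) = k \<and> (\<forall>i. count (image_mset \<pi> \<mu>) i \<le> 1) then 1 else 0 :: 'a) =
           (if size \<mu> = k \<and> (\<forall>i. count \<mu> i \<le> 1) then 1 else 0))"
    by (intro conjI exI[of _ k] allI impI) (simp, simp only: size_image_mset *)
qed

text \<open>The sum \<open>X = x\<^sub>0 + x\<^sub>1 + x\<^sub>2 + \<dots>\<close> of all variables.\<close>

lift_definition varsum :: "'a::comm_ring_1 symfun" is "\<lambda>\<mu>. if size \<mu> = 1 then 1 else 0"
  by (auto intro!: exI[of _ 1])

section \<open>The ground field\<close>

text \<open>The fraction field of \<open>\<rat>[q][t]\<close>: the inner polynomial variable is \<open>q\<close>, the outer one \<open>t\<close>.\<close>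

type_synonym ratqt = "rat poly poly fract"

definition qq :: ratqt where "qq = Fract [:[:0, 1:]:] 1"

definition tt :: ratqt where "tt = Fract [:0, 1:] 1"

definition MM :: ratqt where "MM = (1 - tt) * (1 - qq)"

definition raise_poly :: "nat \<Rightarrow> rat poly poly \<Rightarrow> rat poly poly" where
  "raise_poly k p = pcompose (map_poly (\<lambda>c. pcompose c (monom 1 k)) p) (monom 1 k)"

lemma raise_poly_mult: "raise_poly k (a * b) = raise_poly k a * raise_poly k b"
proof -
  have "map_poly (\<lambda>c. pcompose c (monom 1 k)) (a * b) =
        map_poly (\<lambda>c. pcompose c (monom 1 k)) a * map_poly (\<lambda>c. pcompose c (monom 1 k)) b"
    by (rule poly_eqI) (simp add: coeff_map_poly coeff_mult pcompose_sum pcompose_mult)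
  thus ?thesis by (simp add: raise_poly_def pcompose_mult)
qed

lemma raise_poly_eq_0_iff:
  assumes "k > 0"
  shows "raise_poly k a = 0 \<longleftrightarrow> a = 0"
proof -
  have *: "pcompose c (monom 1 k) = 0 \<longleftrightarrow> c = 0" for c :: "'b::idom poly"
    using assms by (subst pcompose_eq_0_iff) (simp_all add: degree_monom_eq)
  have "map_poly (\<lambda>c. pcompose c (monom 1 k)) a = 0 \<longleftrightarrow> a = 0"
    by (simp add: poly_eq_iff[of _ "0 :: rat poly poly"] coeff_map_poly *)
  thus ?thesis by (simp add: raise_poly_def *)
qed

text \<open>
  The substitution \<open>q \<mapsto> q\<^sup>k\<close>, \<open>t \<mapsto> t\<^sup>k\<close> on \<open>\<rat>(q,t)\<close>, for \<open>k \<ge> 1\<close>. The value at \<open>k = 0\<close> is never used.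
\<close>

definition raise_qt :: "nat \<Rightarrow> ratqt \<Rightarrow> ratqt" where
  "raise_qt k x = (if k = 0 then 0 else
     (THE y. \<exists>a b. b \<noteq> 0 \<and> x = Fract a b \<and> y = Fract (raise_poly k a) (raise_poly k b)))"

lemma raise_qt_Fract:
  assumes "k > 0" "b \<noteq> 0"
  shows "raise_qt k (Fract a b) = Fract (raise_poly k a) (raise_poly k b)"
proof -
  have "Fract (raise_poly k c) (raise_poly k d) = Fract (raise_poly k a) (raise_poly k b)"
    if "d \<noteq> 0" "Fract a b = Fract c d" for c d
    using that assms by (simp add: eq_fract raise_poly_eq_0_iff flip: raise_poly_mult)
  hence "(THE y. \<exists>c d. d \<noteq> 0 \<and> Fract a b = Fract c d \<and> y = Fract (raise_poly k c) (raise_poly k d)) =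
         Fract (raise_poly k a) (raise_poly k b)"
    using assms by (intro the_equality) blast+
  thus ?thesis using assms by (simp add: raise_qt_def)
qed

lemma raise_qt_0: "raise_qt k 0 = 0"
proof (cases "k = 0")
  case False
  thus ?thesis
    using raise_qt_Fract[of k 1 0] by (simp add: raise_poly_eq_0_iff eq_fract Zero_fract_def)
qed (simp add: raise_qt_def)

text \<open>
  Raising all of \<open>q\<close>, \<open>t\<close> and the \<open>x\<^sub>i\<close> to the \<open>k\<close>-th power. For \<open>k \<ge> 1\<close> the sum below has at most
  one term.
\<close>

lift_definition raise_sym :: "nat \<Rightarrow> ratqt symfun \<Rightarrow> ratqt symfun" is
  "\<lambda>k f \<mu>. \<Sum>\<nu> | repeat_mset k \<nu> = \<mu>. raise_qt k (f \<nu>)"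
proof -
  fix k and f :: "nat multiset \<Rightarrow> ratqt"
  assume f: "(\<exists>d. \<forall>\<mu>. size \<mu> > d \<longrightarrow> f \<mu> = 0) \<and> (\<forall>\<pi> \<mu>. bij \<pi> \<longrightarrow> f (image_mset \<pi> \<mu>) = f \<mu>)"
  then obtain d where d: "\<And>\<mu>. size \<mu> > d \<Longrightarrow> f \<mu> = 0" by blast
  have "(\<Sum>\<nu> | repeat_mset k \<nu> = \<mu>. raise_qt k (f \<nu>)) = 0" if "size \<mu> > k * d" for \<mu>
    by (rule sum.neutral) (use that d in \<open>auto simp: raise_qt_0\<close>)
  moreover have "(\<Sum>\<nu> | repeat_mset k \<nu> = image_mset \<pi> \<mu>. raise_qt k (f \<nu>)) =
                 (\<Sum>\<nu> | repeat_mset k \<nu> = \<mu>. raise_qt k (f \<nu>))" if "bij \<pi>" for \<pi> \<mu>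
  proof -
    have l: "image_mset (inv \<pi>) (image_mset \<pi> \<alpha>) = \<alpha>" for \<alpha>
      using that by (simp add: multiset.map_comp bij_is_inj)
    have r: "image_mset \<pi> (image_mset (inv \<pi>) \<alpha>) = \<alpha>" for \<alpha>
      using that by (simp add: multiset.map_comp comp_def bij_is_surj surj_f_inv_f)
    have rep: "image_mset \<rho> (repeat_mset k \<alpha>) = repeat_mset k (image_mset \<rho> \<alpha>)"
      for \<rho> :: "nat \<Rightarrow> nat" and \<alpha>
      by (induction k) auto
    show ?thesis
      by (rule sum.reindex_bij_witness[where i = "image_mset \<pi>" and j = "image_mset (inv \<pi>)"])
         (use f that bij_imp_bij_inv[OF that] in \<open>auto simp: l r simp flip: rep\<close>)
  qed
  ultimately show "(\<exists>d. \<forall>\<mu>. size \<mu> > d \<longrightarrow> (\<Sum>\<nu> | repeat_mset k \<nu> = \<mu>. raise_qt k (f \<nu>)) = 0) \<and>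
     (\<forall>\<pi> \<mu>. bij \<pi> \<longrightarrow> (\<Sum>\<nu> | repeat_mset k \<nu> = image_mset \<pi> \<mu>. raise_qt k (f \<nu>)) =
                      (\<Sum>\<nu> | repeat_mset k \<nu> = \<mu>. raise_qt k (f \<nu>)))"
    by blast
qed

section \<open>Plethysm\<close>

text \<open>
  Plethystic expressions are Laurent series in \<open>z\<close> over the symmetric functions; \<open>pleth_p k E\<close> is
  \<open>p\<^sub>k[E]\<close>, that is, \<open>E\<close> with all of its variables (\<open>q\<close>, \<open>t\<close>, \<open>z\<close> and the \<open>x\<^sub>i\<close>) raised to the
  \<open>k\<close>-th power.
\<close>

definition pleth_p :: "nat \<Rightarrow> ratqt symfun fls \<Rightarrow> ratqt symfun fls" where
  "pleth_p k E = fls_compose_power (Abs_fls (\<lambda>n. raise_sym k (E $$ n))) k"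

definition power_sum :: "nat \<Rightarrow> ratqt symfun" where
  "power_sum k = raise_sym k varsum"

text \<open>
  The unique expansion \<open>F = \<Sum> c\<^sub>\<nu> p\<^sub>\<nu>\<close> of a symmetric function in power sums, partitions \<open>\<nu>\<close> being
  the multisets of their (positive) parts; that is, \<open>F\<close> as a polynomial in \<open>p\<^sub>1, p\<^sub>2, \<dots>\<close>.
\<close>

definition power_sum_expansion :: "ratqt symfun \<Rightarrow> (nat multiset \<Rightarrow>\<^sub>0 ratqt)" where
  "power_sum_expansion F = (THE c. (\<forall>\<nu>\<in>Poly_Mapping.keys c. 0 \<notin># \<nu>) \<and>
     F = (\<Sum>\<nu>\<in>Poly_Mapping.keys c. scale (Poly_Mapping.lookup c \<nu>) (\<Prod>k\<in>#\<nu>. power_sum k)))"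

text \<open>\<open>F[E]\<close>: substitute \<open>p\<^sub>k[E]\<close> for \<open>p\<^sub>k\<close>, leaving the coefficients of \<open>F\<close> alone.\<close>

definition plethysm :: "ratqt symfun \<Rightarrow> ratqt symfun fls \<Rightarrow> ratqt symfun fls" where
  "plethysm F E = (\<Sum>\<nu>\<in>Poly_Mapping.keys (power_sum_expansion F).
     fls_const (const (Poly_Mapping.lookup (power_sum_expansion F) \<nu>)) * (\<Prod>k\<in>#\<nu>. pleth_p k E))"

text \<open>
  \<open>\<Omega>[E] = exp (\<Sum>\<^bsub>k\<ge>1\<^esub> p\<^sub>k[E] / k)\<close> for \<open>E\<close> divisible by \<open>z\<close>. Then \<open>p\<^sub>k[E]\<close> is divisible by \<open>z\<^sup>k\<close>, so
  only \<open>k \<le> n\<close> contribute to the coefficient of \<open>z\<^sup>n\<close> in the inner sum, and that sum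
  has no constant term, so that it can be substituted into the exponential series.
\<close>

definition Omega :: "ratqt symfun fls \<Rightarrow> ratqt symfun fps" where
  "Omega E = fps_compose (Abs_fps (\<lambda>j. const (1 / fact j)))
     (Abs_fps (\<lambda>n. \<Sum>k=1..n. scale (1 / of_nat k) (pleth_p k E $$ int n)))"

section \<open>The operators\<close>

type_synonym sym_op = "ratqt symfun \<Rightarrow> ratqt symfun"

definition D_op :: "int \<Rightarrow> sym_op" where
  "D_op k F =
     (plethysm F (fls_const varsum + fls_const (const MM) * fls_X_inv)
        * fps_to_fls (Omega (- (fls_X * fls_const varsum)))) $$ k"

definition e1_op :: sym_op where
  "e1_op F = elem_sym 1 * F"

definition commutator :: "sym_op \<Rightarrow> sym_op \<Rightarrow> sym_op" where
  "commutator A B = (\<lambda>F. A (B F) - B (A F))"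

text \<open>
  \<open>Split m n = ((a, b), (c, d))\<close> stands for \<open>Split(m,n) = (a,b) + (c,d)\<close>; it is meaningful
  for coprime \<open>m, n \<ge> 1\<close>.
\<close>

definition Split :: "nat \<Rightarrow> nat \<Rightarrow> (nat \<times> nat) \<times> (nat \<times> nat)" where
  "Split m n =
     (if m = 1 then ((1, n - 1), (0, 1))
      else if n = 1 then ((1, 0), (m - 1, 1))
      else let (a, b) = (THE (a, b). 1 \<le> a \<and> a \<le> m - 1 \<and> 1 \<le> b \<and> b \<le> n - 1 \<and> m * b + 1 = n * a)
           in ((a, b), (m - a, n - b)))"

lemma ex1_Split:
  fixes m n :: nat
  assumes "coprime m n" "m > 1" "n > 1"
  shows "\<exists>!(a, b). 1 \<le> a \<and> a \<le> m - 1 \<and> 1 \<le> b \<and> b \<le> n - 1 \<and> m * b + 1 = n * a"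
proof -
  obtain x y where xy: "n * x = m * y + 1"
    using coprime_bezout_strong[of n m] assms by (auto simp: coprime_commute)
  define a where "a = x mod m"
  have "n * a mod m = 1"
    using xy assms by (metis a_def mod_mult_right_eq mod_mult_self4 mod_less)
  hence "n * a = m * (n * a div m) + 1"
    by (metis mult_div_mod_eq)
  then obtain b where b: "m * b + 1 = n * a" by metis
  have a: "a < m" using assms by (simp add: a_def)
  have "a > 0" using b by (cases a) auto
  have "n > 0" "m > 0" using assms by auto
  have "b < n"
  proof (rule ccontr)
    assume "\<not> b < n"
    hence "m * n \<le> m * b" by simp
    moreover have "n * a \<le> n * m" using a by simp
    ultimately show False using b mult.commute[of m n] by linarith
  qed
  have "b > 0"
    using b \<open>n > 1\<close> by (cases b) auto
  show ?thesis
  proof (rule ex1I[of _ "(a, b)"])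
    show "case (a, b) of (a, b) \<Rightarrow> 1 \<le> a \<and> a \<le> m - 1 \<and> 1 \<le> b \<and> b \<le> n - 1 \<and> m * b + 1 = n * a"
      using a b \<open>a > 0\<close> \<open>b > 0\<close> \<open>b < n\<close> by auto
    fix p :: "nat \<times> nat"
    assume "case p of (a, b) \<Rightarrow> 1 \<le> a \<and> a \<le> m - 1 \<and> 1 \<le> b \<and> b \<le> n - 1 \<and> m * b + 1 = n * a"
    then obtain a' b' where p: "p = (a', b')" "a' \<le> m - 1" "m * b' + 1 = n * a'"
      by (cases p) auto
    have "[n * a' = n * a] (mod m)"
      using b p(3) by (metis cong_def mod_mult_self4)
    hence "[a' = a] (mod m)"
      using assms by (simp add: cong_mult_lcancel_nat coprime_commute)
    hence "a' = a"
      using a p(2) \<open>m > 0\<close> by (simp add: cong_def)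
    moreover from this have "b' = b"
      using b p(3) \<open>m > 0\<close> by (metis add_right_cancel mult_left_cancel less_irrefl)
    ultimately show "p = (a, b)" using p by simp
  qed
qed

lemma Split_less:
  assumes "coprime m n" "m \<ge> 1" "n \<ge> 1" "Split m n = ((a, b), (c, d))"
  shows "a + b < m + n" "c + d < m + n"
proof -
  have "a + b < m + n \<and> c + d < m + n"
  proof (cases "m = 1 \<or> n = 1")
    case True
    thus ?thesis using assms by (auto simp: Split_def split: if_splits)
  next
    case False
    hence "m > 1" "n > 1" using assms by auto
    from theI'[OF ex1_Split[OF assms(1) this]] show ?thesis
      using assms(4) False by (auto simp: Split_def Let_def case_prod_unfold)
  qed
  thus "a + b < m + n" "c + d < m + n" by auto
qed

text \<open>The value \<open>\<lambda>_. 0\<close> is a dummy for the pairs that are not coprime.\<close>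

function Q_op :: "nat \<Rightarrow> nat \<Rightarrow> sym_op" where
  "Q_op m n =
     (if m = 1 \<and> n = 0 then D_op 0
      else if m = 0 \<and> n = 1 then (\<lambda>F. - e1_op F)
      else if m \<ge> 1 \<and> n \<ge> 1 \<and> coprime m n then
        (case Split m n of ((a, b), (c, d)) \<Rightarrow>
           (\<lambda>F. scale (1 / MM) (commutator (Q_op c d) (Q_op a b) F)))
      else (\<lambda>_. 0))"
  by pat_completeness auto
termination
  by (relation "measure (\<lambda>(m, n). m + n)") (auto dest: Split_less Split_less[OF _ _ _ sym])

declare Q_op.simps [simp del]

end

theory Submission
  imports Defs "HOL-Combinatorics.Permutations"
begin

text \<open>
  Since \<open>e\<^sub>1[X + M/z] = e\<^sub>1 + M/z\<close> and \<open>F \<mapsto> F[X + M/z]\<close> is a ring homomorphism, comparing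
  coefficients of \<open>z\<^sup>n\<close> gives \<open>[D\<^sub>n, e\<^sub>1] = M D\<^bsub>n+1\<^esub>\<close>, from which \<open>Q\<^bsub>1,n\<^esub> = D\<^sub>n\<close> follows by induction
  on \<open>n\<close>. As plethysm is defined through the expansion in power sums, this rests on the products
  \<open>p\<^sub>\<nu>\<close> being a basis of the symmetric functions. They are, by triangularity: if \<open>x\<^sup>\<mu>\<close> occurs in
  \<open>p\<^sub>\<nu>\<close>, then either \<open>\<nu>\<close> is the multiset of the exponents of \<open>x\<^sup>\<mu>\<close>, or \<open>x\<^sup>\<mu>\<close> involves fewer
  variables than \<open>\<nu>\<close> has parts.
\<close>

section \<open>Triangular families and expansions in a basis\<close>

locale triangular_family = vector_space scale
  for scale :: "'a::field \<Rightarrow> 'b::ab_group_add \<Rightarrow> 'b" (infixr \<open>*s\<close> 75) +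
  fixes I :: "'i set" and vec :: "'i \<Rightarrow> 'b" and coord :: "'i \<Rightarrow> 'b \<Rightarrow> 'a" and rank :: "'i \<Rightarrow> nat"
  assumes linear_coord: "i \<in> I \<Longrightarrow> Vector_Spaces.linear scale (*) (coord i)"
    and coord_diagonal: "i \<in> I \<Longrightarrow> coord i (vec i) \<noteq> 0"
    and rank_less: "\<lbrakk>i \<in> I; j \<in> I; coord i (vec j) \<noteq> 0; i \<noteq> j\<rbrakk> \<Longrightarrow> rank i < rank j"
begin

lemma coord_sum_scale:
  assumes "i \<in> I"
  shows "coord i (\<Sum>j\<in>J. u j *s f j) = (\<Sum>j\<in>J. u j * coord i (f j))"
proof -
  interpret Vector_Spaces.linear scale "(*)" "coord i" by (rule linear_coord[OF assms])
  show ?thesis by (simp add: sum scale)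
qed

lemma coord_diff: "i \<in> I \<Longrightarrow> coord i (v - w) = coord i v - coord i w"
  using linear_coord by (metis module_hom.diff module_hom_iff_linear)

lemma inj_on_vec: "inj_on vec I"
proof (rule inj_onI, rule ccontr)
  fix i j assume "i \<in> I" "j \<in> I" "vec i = vec j" "i \<noteq> j"
  hence "rank i < rank j" "rank j < rank i"
    using coord_diagonal rank_less by metis+
  thus False by simp
qed

lemma independent_vec: "independent (vec ` I)"
  unfolding independent_explicit_finite_subsets
proof (intro allI impI ballI, rule ccontr)
  fix S u v
  assume S: "S \<subseteq> vec ` I" "finite S" and zero: "(\<Sum>w\<in>S. u w *s w) = 0" and v: "v \<in> S" "u v \<noteq> 0"
  define T where "T = {i \<in> I. vec i \<in> S \<and> u (vec i) \<noteq> 0}"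
  have "finite T"
    by (rule inj_on_finite[OF inj_on_subset[OF inj_on_vec] _ \<open>finite S\<close>]) (auto simp: T_def)
  moreover have "T \<noteq> {}" using S v by (auto simp: T_def)
  ultimately have "Max (rank ` T) \<in> rank ` T" by simp
  then obtain i where i: "i \<in> T" and "rank i = Max (rank ` T)" by (metis imageE)
  hence rank_le: "rank j \<le> rank i" if "j \<in> T" for j
    using that \<open>finite T\<close> by simp
  have "i \<in> I" using i by (simp add: T_def)
  have "0 = coord i (\<Sum>w\<in>S. u w *s w)"
    using coord_diff[OF \<open>i \<in> I\<close>, of 0 0] by (simp add: zero)
  also have "\<dots> = (\<Sum>w\<in>S. u w * coord i w)"
    by (rule coord_sum_scale[OF \<open>i \<in> I\<close>])
  also have "\<dots> = (\<Sum>w\<in>{vec i}. u w * coord i w)"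
  proof (rule sum.mono_neutral_right)
    show "\<forall>w\<in>S - {vec i}. u w * coord i w = 0"
    proof (rule ballI, rule ccontr)
      fix w assume w: "w \<in> S - {vec i}" "u w * coord i w \<noteq> 0"
      then obtain j where j: "j \<in> I" "w = vec j" using S by blast
      hence "rank i < rank j" using rank_less[OF \<open>i \<in> I\<close> j(1)] w by auto
      moreover have "j \<in> T" using j w by (simp add: T_def)
      ultimately show False using rank_le by fastforce
    qed
  qed (use S i in \<open>auto simp: T_def\<close>)
  finally show False using i coord_diagonal[OF \<open>i \<in> I\<close>] by (simp add: T_def)
qed

end

locale triangular_basis = triangular_family +
  assumes finite_coord_support: "finite {i \<in> I. coord i v \<noteq> 0}"
    and eq_0_if_coord_eq_0: "(\<And>i. i \<in> I \<Longrightarrow> coord i v = 0) \<Longrightarrow> v = 0"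
begin

lemma ex_span_vec_same_top_coords:
  assumes "\<And>i. i \<in> I \<Longrightarrow> coord i v \<noteq> 0 \<Longrightarrow> rank i \<le> N"
  shows "\<exists>w\<in>span (vec ` I). \<forall>i\<in>I. N \<le> rank i \<longrightarrow> coord i w = coord i v"
proof (intro bexI ballI impI)
  define J where "J = {i \<in> I. coord i v \<noteq> 0 \<and> rank i = N}"
  let ?w = "\<Sum>j\<in>J. (coord j v / coord j (vec j)) *s vec j"
  show "?w \<in> span (vec ` I)"
    by (intro span_sum span_scale span_base) (auto simp: J_def)
  fix i assume i: "i \<in> I" "N \<le> rank i"
  have "coord i ?w = (\<Sum>j\<in>J. coord j v / coord j (vec j) * coord i (vec j))"
    by (rule coord_sum_scale[OF \<open>i \<in> I\<close>])
  also have "\<dots> = (\<Sum>j\<in>J. if j = i then coord i v else 0)"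
  proof (rule sum.cong)
    fix j assume "j \<in> J"
    hence "coord i (vec j) = 0" if "j \<noteq> i"
      using that rank_less[of i j] i by (auto simp: J_def)
    thus "coord j v / coord j (vec j) * coord i (vec j) = (if j = i then coord i v else 0)"
      using coord_diagonal[OF \<open>i \<in> I\<close>] by auto
  qed simp
  also have "\<dots> = (if i \<in> J then coord i v else 0)"
    using finite_subset[OF _ finite_coord_support[of v], of J] by (simp add: J_def subset_iff)
  also have "\<dots> = coord i v"
    using assms[of i] i by (auto simp: J_def)
  finally show "coord i ?w = coord i v" .
qed

lemma in_span_vec_if_rank_less:
  assumes "\<And>i. i \<in> I \<Longrightarrow> coord i v \<noteq> 0 \<Longrightarrow> rank i < N"
  shows "v \<in> span (vec ` I)"
  using assms
proof (induction N arbitrary: v)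
  case 0
  hence "v = 0" using eq_0_if_coord_eq_0 by blast
  thus ?case by (simp add: span_zero)
next
  case (Suc N)
  obtain w where w: "w \<in> span (vec ` I)" "\<forall>i\<in>I. N \<le> rank i \<longrightarrow> coord i w = coord i v"
    using ex_span_vec_same_top_coords[of v N] Suc.prems by (auto simp: less_Suc_eq_le)
  have "v - w \<in> span (vec ` I)"
  proof (rule Suc.IH)
    fix i assume "i \<in> I" "coord i (v - w) \<noteq> 0"
    thus "rank i < N" using w(2) by (force simp: coord_diff)
  qed
  from span_add[OF this w(1)] show ?case by simp
qed

lemma span_vec: "span (vec ` I) = UNIV"
proof (intro equalityI subsetI UNIV_I)
  fix v
  have "rank i < Suc (Max (rank ` {i \<in> I. coord i v \<noteq> 0}))" if "i \<in> I" "coord i v \<noteq> 0" for i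
    using that finite_coord_support by (simp add: less_Suc_eq_le)
  thus "v \<in> span (vec ` I)" by (rule in_span_vec_if_rank_less)
qed

end

definition (in vector_space) combination :: "('i \<Rightarrow> 'b) \<Rightarrow> ('i \<Rightarrow>\<^sub>0 'a) \<Rightarrow> 'b" where
  "combination b c = (\<Sum>i\<in>Poly_Mapping.keys c. scale (Poly_Mapping.lookup c i) (b i))"

lemma (in vector_space_pair) linear_combination:
  assumes "Vector_Spaces.linear s1 s2 T"
  shows "T (vs1.combination b c) = vs2.combination (\<lambda>i. T (b i)) c"
proof -
  interpret T: Vector_Spaces.linear s1 s2 T by fact
  show ?thesis by (simp add: vs1.combination_def vs2.combination_def T.sum T.scale)
qed

context vector_space
begin

lemma representation_combination:
  assumes "inj_on b I" "independent (b ` I)" "Poly_Mapping.keys c \<subseteq> I" "j \<in> I"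
  shows "representation (b ` I) (combination b c) (b j) = Poly_Mapping.lookup c j"
proof -
  have in_span: "scale a (b i) \<in> span (b ` I)" if "i \<in> Poly_Mapping.keys c" for a i
    using that assms(3) by (intro span_scale span_base) auto
  have "representation (b ` I) (scale a (b i)) (b j) = (if i = j then a else 0)"
    if "i \<in> Poly_Mapping.keys c" for a i
  proof -
    have "i \<in> I" using that assms(3) by auto
    thus ?thesis
      using assms by (simp add: representation_scale span_base representation_basis inj_on_eq_iff)
  qed
  hence "representation (b ` I) (combination b c) (b j) =
      (if j \<in> Poly_Mapping.keys c then Poly_Mapping.lookup c j else 0)"
    using assms(2) in_span by (simp add: combination_def representation_sum)
  thus ?thesis by (simp add: in_keys_iff)
qed

lemma ex_combination_eq:
  assumes "inj_on b I" "independent (b ` I)" "v \<in> span (b ` I)"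
  shows "\<exists>c. Poly_Mapping.keys c \<subseteq> I \<and> combination b c = v"
proof (intro exI conjI)
  define r where "r = representation (b ` I) v"
  define f where "f i = (if i \<in> I then r (b i) else 0)" for i
  define c where "c = Abs_poly_mapping f"
  have support_f: "{i. f i \<noteq> 0} = {i \<in> I. r (b i) \<noteq> 0}" by (auto simp: f_def)
  have "finite {i. f i \<noteq> 0}"
    unfolding support_f
    by (rule inj_on_finite[OF inj_on_subset[OF assms(1)] _ finite_representation[of "b ` I" v]])
       (auto simp: r_def)
  hence lookup_c: "Poly_Mapping.lookup c = f"
    unfolding c_def by (rule lookup_Abs_poly_mapping)
  hence keys_c: "Poly_Mapping.keys c = {i \<in> I. r (b i) \<noteq> 0}"
    using support_f by (simp add: set_eq_iff in_keys_iff)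
  thus "Poly_Mapping.keys c \<subseteq> I" by auto
  have "combination b c = (\<Sum>i\<in>Poly_Mapping.keys c. scale (r (b i)) (b i))"
    unfolding combination_def by (rule sum.cong) (simp_all add: lookup_c f_def keys_c)
  also have "\<dots> = (\<Sum>w\<in>b ` Poly_Mapping.keys c. scale (r w) w)"
    using inj_on_subset[OF assms(1), of "Poly_Mapping.keys c"] by (simp add: sum.reindex keys_c)
  also have "b ` Poly_Mapping.keys c = {w. r w \<noteq> 0}"
    unfolding keys_c using representation_ne_zero[of "b ` I" v] by (auto simp: r_def)
  also have "(\<Sum>w | r w \<noteq> 0. scale (r w) w) = v"
    unfolding r_def using assms by (simp add: sum_nonzero_representation_eq)
  finally show "combination b c = v" .
qed

lemma ex1_combination_eq:
  assumes "inj_on b I" "independent (b ` I)" "v \<in> span (b ` I)"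
  shows "\<exists>!c. Poly_Mapping.keys c \<subseteq> I \<and> combination b c = v"
proof (rule ex_ex1I[OF ex_combination_eq[OF assms]])
  fix c c'
  assume c: "Poly_Mapping.keys c \<subseteq> I \<and> combination b c = v"
    and c': "Poly_Mapping.keys c' \<subseteq> I \<and> combination b c' = v"
  show "c = c'"
  proof (rule poly_mapping_eqI)
    fix i
    show "Poly_Mapping.lookup c i = Poly_Mapping.lookup c' i"
    proof (cases "i \<in> I")
      case True
      thus ?thesis using representation_combination[OF assms(1,2)] c c' by metis
    next
      case False
      thus ?thesis using c c' by (metis in_keys_iff subsetD)
    qed
  qed
qed

end

section \<open>Exponents of monomials\<close>

definition exponents :: "'b multiset \<Rightarrow> nat multiset" where
  "exponents \<mu> = image_mset (count \<mu>) (mset_set (set_mset \<mu>))"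

lemma size_exponents: "size (exponents \<mu>) = card (set_mset \<mu>)"
  by (simp add: exponents_def)

lemma sum_mset_exponents: "sum_mset (exponents \<mu>) = size \<mu>"
  by (simp add: exponents_def size_multiset_overloaded_eq sum_unfold_sum_mset)

lemma zero_notin_exponents: "0 \<notin># exponents \<mu>"
  by (auto simp: exponents_def simp flip: not_in_iff)

lemma exponents_replicate_mset_add:
  assumes "k > 0" "i \<notin># \<mu>"
  shows "exponents (replicate_mset k i + \<mu>) = add_mset k (exponents \<mu>)"
proof -
  have "set_mset (replicate_mset k i + \<mu>) = insert i (set_mset \<mu>)"
    using assms(1) by auto
  moreover have "image_mset (count (replicate_mset k i + \<mu>)) (mset_set (set_mset \<mu>)) = exponents \<mu>"
    unfolding exponents_def using assms(2) by (intro image_mset_cong) auto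
  ultimately show ?thesis
    using assms(2) by (simp add: exponents_def not_in_iff)
qed

lemma ex_exponents_eq:
  assumes "0 \<notin># \<nu>"
  shows "\<exists>\<mu> :: nat multiset. exponents \<mu> = \<nu>"
  using assms
proof (induction \<nu>)
  case empty
  have "exponents {#} = {#}" by (simp add: exponents_def)
  thus ?case by blast
next
  case (add k \<nu>)
  then obtain \<mu> :: "nat multiset" where "exponents \<mu> = \<nu>" by auto
  moreover obtain i where "i \<notin># \<mu>"
    using ex_new_if_finite[OF infinite_UNIV_nat finite_set_mset] by blast
  ultimately have "exponents (replicate_mset k i + \<mu>) = add_mset k \<nu>"
    using add.prems by (simp add: exponents_replicate_mset_add)
  thus ?case by blast
qed

lemma image_mset_count_superset:
  assumes "finite A" "set_mset \<mu> \<subseteq> A"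
  shows "image_mset (count \<mu>) (mset_set A) =
    exponents \<mu> + replicate_mset (card A - size (exponents \<mu>)) 0"
proof -
  have "mset_set A = mset_set (set_mset \<mu>) + mset_set (A - set_mset \<mu>)"
    using assms by (subst mset_set_Union[symmetric]) (auto simp: Un_absorb1)
  moreover have "image_mset (count \<mu>) (mset_set (A - set_mset \<mu>)) =
      image_mset (\<lambda>_. 0) (mset_set (A - set_mset \<mu>))"
    using assms(1) by (intro image_mset_cong) (auto simp: not_in_iff)
  ultimately show ?thesis
    using assms by (simp add: exponents_def image_mset_const_eq card_Diff_subset)
qed

lemma count_image_mset_inj:
  assumes "inj f"
  shows "count (image_mset f \<mu>) (f x) = count \<mu> x"
  using assms by (induction \<mu>) (auto simp: inj_eq)

lemma exponents_eqE:
  fixes \<mu> \<mu>' :: "'b multiset"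
  assumes "exponents \<mu> = exponents \<mu>'"
  obtains \<pi> where "bij \<pi>" "image_mset \<pi> \<mu> = \<mu>'"
proof -
  define A where "A = set_mset \<mu> \<union> set_mset \<mu>'"
  have "image_mset (count \<mu>) (mset_set A) = image_mset (count \<mu>') (mset_set A)"
    by (simp add: image_mset_count_superset A_def assms)
  then obtain \<pi> where \<pi>: "\<pi> permutes A" "\<forall>x\<in>A. count \<mu> x = count \<mu>' (\<pi> x)"
    using image_mset_eq_implies_permutes[of A] by (auto simp: A_def)
  have count_eq: "count \<mu> x = count \<mu>' (\<pi> x)" for x
  proof (cases "x \<in> A")
    case False
    hence "\<pi> x = x" "x \<notin># \<mu>" "x \<notin># \<mu>'" using \<pi>(1) by (auto simp: A_def permutes_def)
    thus ?thesis by (simp add: not_in_iff)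
  qed (use \<pi> in auto)
  have "bij \<pi>" using \<pi>(1) by (rule permutes_bij)
  moreover have "image_mset \<pi> \<mu> = \<mu>'"
  proof (rule multiset_eqI)
    fix y
    obtain x where "y = \<pi> x" using \<open>bij \<pi>\<close> by (metis bij_pointE)
    thus "count (image_mset \<pi> \<mu>) y = count \<mu>' y"
      by (simp add: count_image_mset_inj bij_is_inj[OF \<open>bij \<pi>\<close>] count_eq)
  qed
  ultimately show ?thesis by (rule that)
qed

lemma scoeff_cong_exponents:
  assumes "exponents \<mu> = exponents \<mu>'"
  shows "scoeff f \<mu> = scoeff f \<mu>'"
proof -
  obtain \<pi> where "bij \<pi>" "image_mset \<pi> \<mu> = \<mu>'"
    using exponents_eqE[OF assms] .
  thus ?thesis using scoeff[of f] by auto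
qed

section \<open>Products of power sums\<close>

lemma scoeff_mult_nonzeroE:
  assumes "scoeff (f * g) \<mu> \<noteq> 0"
  obtains \<alpha> \<beta> where "\<mu> = \<alpha> + \<beta>" "scoeff f \<alpha> \<noteq> 0" "scoeff g \<beta> \<noteq> 0"
proof -
  have "\<exists>(\<alpha>, \<beta>)\<in>{(\<alpha>, \<beta>). \<alpha> + \<beta> = \<mu>}. scoeff f \<alpha> * scoeff g \<beta> \<noteq> 0"
    using assms unfolding times_symfun.rep_eq by (auto intro: sum.neutral)
  thus ?thesis using that by force
qed

lemma scoeff_mult_nonneg:
  fixes f g :: "'a::linordered_idom symfun"
  assumes "\<And>\<alpha>. 0 \<le> scoeff f \<alpha>" "\<And>\<beta>. 0 \<le> scoeff g \<beta>"
  shows "0 \<le> scoeff (f * g) \<mu>"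
  unfolding times_symfun.rep_eq using assms by (auto intro!: sum_nonneg)

lemma scoeff_mult_ge:
  fixes f g :: "'a::linordered_idom symfun"
  assumes "\<And>\<alpha>. 0 \<le> scoeff f \<alpha>" "\<And>\<beta>. 0 \<le> scoeff g \<beta>"
  shows "scoeff f \<alpha> * scoeff g \<beta> \<le> scoeff (f * g) (\<alpha> + \<beta>)"
proof -
  have "(case (\<alpha>, \<beta>) of (\<alpha>, \<beta>) \<Rightarrow> scoeff f \<alpha> * scoeff g \<beta>) \<le> scoeff (f * g) (\<alpha> + \<beta>)"
    unfolding times_symfun.rep_eq
    by (rule member_le_sum) (use assms finite_mset_splits in auto)
  thus ?thesis by simp
qed

lemma raise_qt_1_right: "k > 0 \<Longrightarrow> raise_qt k 1 = 1"
  using raise_qt_Fract[of k 1 1] by (simp add: One_fract_def raise_poly_def pcompose_1)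

lemma scoeff_power_sum:
  assumes "k > 0"
  shows "scoeff (power_sum k) \<mu> = (if \<exists>i. \<mu> = replicate_mset k i then 1 else 0)"
proof (cases "\<exists>i. \<mu> = replicate_mset k i")
  case True
  then obtain i where "\<mu> = repeat_mset k {#i#}" by auto
  hence "repeat_mset k \<nu> = \<mu> \<longleftrightarrow> \<nu> = {#i#}" for \<nu>
    using assms by (simp only: repeat_mset_cancel1) simp
  thus ?thesis using True assms
    by (simp add: power_sum_def raise_sym.rep_eq varsum.rep_eq raise_qt_1_right)
next
  case False
  have "size \<nu> \<noteq> 1" if "repeat_mset k \<nu> = \<mu>" for \<nu>
  proof
    assume "size \<nu> = 1"
    then obtain i where "\<nu> = {#i#}" using size_1_singleton_mset by blast
    thus False using that False by auto
  qed
  thus ?thesis using False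
    by (auto simp: power_sum_def raise_sym.rep_eq varsum.rep_eq raise_qt_0 intro!: sum.neutral)
qed

abbreviation partitions :: "nat multiset set" where
  "partitions \<equiv> {\<nu>. 0 \<notin># \<nu>}"

abbreviation power_sum_prod :: "nat multiset \<Rightarrow> ratqt symfun" where
  "power_sum_prod \<nu> \<equiv> (\<Prod>k\<in>#\<nu>. power_sum k)"

text \<open>
  Positivity refers to the order of \<^typ>\<open>ratqt\<close> induced by the leading coefficients of polynomials.
  It serves to rule out cancellation.
\<close>

lemma scoeff_power_sum_prod_nonneg:
  assumes "\<nu> \<in> partitions"
  shows "0 \<le> scoeff (power_sum_prod \<nu>) \<mu>"
  using assms
proof (induction \<nu> arbitrary: \<mu>)
  case (add k \<nu>)
  thus ?case by (auto intro!: scoeff_mult_nonneg simp: scoeff_power_sum)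
qed (simp add: one_symfun.rep_eq)

lemma scoeff_power_sum_prod_exponents_pos:
  assumes "exponents \<mu> = \<nu>"
  shows "0 < scoeff (power_sum_prod \<nu>) \<mu>"
  using assms
proof (induction \<nu> arbitrary: \<mu>)
  case empty
  hence "\<mu> = {#}" using size_exponents[of \<mu>] by simp
  thus ?case by (simp add: one_symfun.rep_eq)
next
  case (add k \<nu>)
  hence pos: "k > 0" "0 \<notin># \<nu>" using zero_notin_exponents[of \<mu>] by auto
  then obtain \<rho> :: "nat multiset" where \<rho>: "exponents \<rho> = \<nu>" using ex_exponents_eq by blast
  obtain i where "i \<notin># \<rho>"
    using ex_new_if_finite[OF infinite_UNIV_nat finite_set_mset] by blast
  hence exponents_eq: "exponents \<mu> = exponents (replicate_mset k i + \<rho>)"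
    using add.prems \<rho> pos by (simp add: exponents_replicate_mset_add)
  have "0 < scoeff (power_sum_prod \<nu>) \<rho>" by (rule add.IH[OF \<rho>])
  also have "\<dots> = scoeff (power_sum k) (replicate_mset k i) * scoeff (power_sum_prod \<nu>) \<rho>"
    using pos by (auto simp: scoeff_power_sum)
  also have "\<dots> \<le> scoeff (power_sum_prod (add_mset k \<nu>)) (replicate_mset k i + \<rho>)"
    using pos scoeff_mult_ge[of "power_sum k" "power_sum_prod \<nu>"] scoeff_power_sum_prod_nonneg
    by (simp add: scoeff_power_sum)
  finally show ?case by (simp only: scoeff_cong_exponents[OF exponents_eq])
qed

lemma scoeff_power_sum_prod_triangular:
  assumes "\<nu> \<in> partitions" "scoeff (power_sum_prod \<nu>) \<mu> \<noteq> 0"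
  shows "exponents \<mu> = \<nu> \<or> size (exponents \<mu>) < size \<nu>"
  using assms
proof (induction \<nu> arbitrary: \<mu>)
  case empty
  thus ?case by (auto simp: one_symfun.rep_eq exponents_def split: if_splits)
next
  case (add k \<nu>)
  have "k > 0" using add.prems by auto
  have "scoeff (power_sum k * power_sum_prod \<nu>) \<mu> \<noteq> 0" using add.prems(2) by simp
  then obtain \<alpha> \<rho> where "\<mu> = \<alpha> + \<rho>" "scoeff (power_sum k) \<alpha> \<noteq> 0"
    and \<rho>: "scoeff (power_sum_prod \<nu>) \<rho> \<noteq> 0"
    by (rule scoeff_mult_nonzeroE)
  then obtain i where \<mu>: "\<mu> = replicate_mset k i + \<rho>"
    using \<open>k > 0\<close> by (auto simp: scoeff_power_sum split: if_splits)
  have IH: "exponents \<rho> = \<nu> \<or> size (exponents \<rho>) < size \<nu>"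
    using add \<rho> by auto
  show ?case
  proof (cases "i \<in># \<rho>")
    case True
    hence "set_mset \<mu> = set_mset \<rho>" using \<mu> \<open>k > 0\<close> by auto
    hence "size (exponents \<mu>) = size (exponents \<rho>)" by (simp add: size_exponents)
    thus ?thesis using IH by auto
  next
    case False
    hence "exponents \<mu> = add_mset k (exponents \<rho>)"
      unfolding \<mu> by (rule exponents_replicate_mset_add[OF \<open>k > 0\<close>])
    thus ?thesis using IH by auto
  qed
qed

section \<open>The power sum basis\<close>

interpretation symfun: vector_space "scale :: 'a::field \<Rightarrow> 'a symfun \<Rightarrow> 'a symfun"
  by unfold_locales (transfer; simp add: algebra_simps)+

lemma linear_scoeff: "Vector_Spaces.linear scale (*) (\<lambda>f. scoeff f \<mu>)"
  by unfold_locales (simp_all add: plus_symfun.rep_eq scale.rep_eq algebra_simps)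

definition monomial_with_exponents :: "nat multiset \<Rightarrow> nat multiset" where
  "monomial_with_exponents \<nu> = (SOME \<mu>. exponents \<mu> = \<nu>)"

lemma exponents_monomial_with_exponents:
  assumes "\<nu> \<in> partitions"
  shows "exponents (monomial_with_exponents \<nu>) = \<nu>"
  unfolding monomial_with_exponents_def using assms by (simp add: someI_ex[OF ex_exponents_eq])

lemma finite_partitions_sum_le: "finite {\<nu> \<in> partitions. sum_mset \<nu> \<le> d}"
proof (rule finite_subset)
  show "{\<nu> \<in> partitions. sum_mset \<nu> \<le> d} \<subseteq> (\<Union>n\<le>d. multisets_of_size {1..d} n)"
  proof
    fix \<nu> assume \<nu>: "\<nu> \<in> {\<nu> \<in> partitions. sum_mset \<nu> \<le> d}"
    have part_ge: "1 \<le> k" if "k \<in># \<nu>" for k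
      using \<nu> that by (cases k) auto
    hence "size \<nu> \<le> sum_mset \<nu>"
      using sum_mset_mono[of \<nu> "\<lambda>_. 1" "\<lambda>k. k"] by simp
    moreover have "k \<le> d" if "k \<in># \<nu>" for k
    proof -
      obtain \<rho> where "\<nu> = add_mset k \<rho>" using multi_member_split[OF \<open>k \<in># \<nu>\<close>] by blast
      thus ?thesis using \<nu> by simp
    qed
    ultimately show "\<nu> \<in> (\<Union>n\<le>d. multisets_of_size {1..d} n)"
      using \<nu> part_ge by (auto simp: multisets_of_size_def)
  qed
qed auto

lemma finite_partitions_scoeff_nonzero:
  "finite {\<nu> \<in> partitions. scoeff f (monomial_with_exponents \<nu>) \<noteq> 0}"
proof -
  obtain d where d: "\<And>\<mu>. d < size \<mu> \<Longrightarrow> scoeff f \<mu> = 0" using scoeff[of f] by auto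
  have "sum_mset \<nu> \<le> d" if "\<nu> \<in> partitions" "scoeff f (monomial_with_exponents \<nu>) \<noteq> 0" for \<nu>
  proof -
    have "sum_mset \<nu> = size (monomial_with_exponents \<nu>)"
      by (simp add: exponents_monomial_with_exponents[OF that(1)] flip: sum_mset_exponents)
    also have "\<dots> \<le> d" using d that(2) by (meson not_less)
    finally show ?thesis .
  qed
  thus ?thesis
    by (intro finite_subset[OF _ finite_partitions_sum_le[of d]]) auto
qed

interpretation power_sums: triangular_basis scale partitions power_sum_prod
  "\<lambda>\<nu> f. scoeff f (monomial_with_exponents \<nu>)" size
proof (intro_locales; intro triangular_family_axioms.intro triangular_basis_axioms.intro)
  fix \<nu> \<kappa> :: "nat multiset"
  assume \<nu>: "\<nu> \<in> partitions"
  show "Vector_Spaces.linear scale (*) (\<lambda>f :: ratqt symfun. scoeff f (monomial_with_exponents \<nu>))"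
    by (rule linear_scoeff)
  show "scoeff (power_sum_prod \<nu>) (monomial_with_exponents \<nu>) \<noteq> 0"
    using scoeff_power_sum_prod_exponents_pos[OF exponents_monomial_with_exponents[OF \<nu>]] by simp
  show "size \<nu> < size \<kappa>"
    if "\<kappa> \<in> partitions" "scoeff (power_sum_prod \<kappa>) (monomial_with_exponents \<nu>) \<noteq> 0" "\<nu> \<noteq> \<kappa>"
    using scoeff_power_sum_prod_triangular[OF that(1,2)] that(3)
    by (simp add: exponents_monomial_with_exponents[OF \<nu>])
next
  fix f :: "ratqt symfun"
  show "finite {\<nu> \<in> partitions. scoeff f (monomial_with_exponents \<nu>) \<noteq> 0}"
    by (rule finite_partitions_scoeff_nonzero)
  assume zero: "\<And>\<nu>. \<nu> \<in> partitions \<Longrightarrow> scoeff f (monomial_with_exponents \<nu>) = 0"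
  show "f = 0"
  proof (rule symfun_eqI)
    fix \<mu> :: "nat multiset"
    have exponents: "exponents \<mu> \<in> partitions" by (simp add: zero_notin_exponents)
    have "scoeff f \<mu> = scoeff f (monomial_with_exponents (exponents \<mu>))"
      by (rule scoeff_cong_exponents) (simp only: exponents_monomial_with_exponents[OF exponents])
    also have "\<dots> = 0" by (rule zero[OF exponents])
    finally show "scoeff f \<mu> = scoeff 0 \<mu>" by (simp add: zero_symfun.rep_eq)
  qed
qed

lemma
  shows keys_power_sum_expansion: "Poly_Mapping.keys (power_sum_expansion F) \<subseteq> partitions"
    and combination_power_sum_expansion:
      "symfun.combination power_sum_prod (power_sum_expansion F) = F"
proof -
  have "(\<forall>\<nu>\<in>Poly_Mapping.keys c. 0 \<notin># \<nu>) \<and>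
      F = (\<Sum>\<nu>\<in>Poly_Mapping.keys c. scale (Poly_Mapping.lookup c \<nu>) (power_sum_prod \<nu>)) \<longleftrightarrow>
      Poly_Mapping.keys c \<subseteq> partitions \<and> symfun.combination power_sum_prod c = F" for c
    by (auto simp: symfun.combination_def)
  hence expansion_eq: "power_sum_expansion F =
      (THE c. Poly_Mapping.keys c \<subseteq> partitions \<and> symfun.combination power_sum_prod c = F)"
    by (simp only: power_sum_expansion_def)
  have "\<exists>!c. Poly_Mapping.keys c \<subseteq> partitions \<and> symfun.combination power_sum_prod c = F"
    by (rule symfun.ex1_combination_eq[OF power_sums.inj_on_vec power_sums.independent_vec])
       (simp add: power_sums.span_vec)
  from theI'[OF this] have "Poly_Mapping.keys (power_sum_expansion F) \<subseteq> partitions \<and>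
      symfun.combination power_sum_prod (power_sum_expansion F) = F"
    unfolding expansion_eq .
  thus "Poly_Mapping.keys (power_sum_expansion F) \<subseteq> partitions"
    "symfun.combination power_sum_prod (power_sum_expansion F) = F" by simp_all
qed

section \<open>Plethysm as a ring homomorphism\<close>

lemma scale_mult_left: "scale a f * g = scale a (f * g)"
  by (rule symfun_eqI)
     (simp add: times_symfun.rep_eq scale.rep_eq sum_distrib_left case_prod_unfold mult.assoc)

lemma const_mult: "const a * f = scale a f"
  by (simp add: scale_mult_left)

abbreviation scale_fls :: "ratqt \<Rightarrow> ratqt symfun fls \<Rightarrow> ratqt symfun fls" where
  "scale_fls a f \<equiv> fls_const (const a) * f"

interpretation laurent: vector_space scale_fls
proof
  fix a b :: ratqt and f g :: "ratqt symfun fls"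
  show "scale_fls a (f + g) = scale_fls a f + scale_fls a g" by (rule distrib_left)
  show "scale_fls (a + b) f = scale_fls a f + scale_fls b f"
    by (simp add: symfun.scale_left_distrib distrib_right flip: fls_plus_const)
  show "scale_fls a (scale_fls b f) = scale_fls (a * b) f"
    by (simp only: mult.assoc[symmetric] fls_const_mult_const const_mult symfun.scale_scale)
  show "scale_fls 1 f = f" by simp
qed

interpretation symfun_laurent: vector_space_pair
  "scale :: ratqt \<Rightarrow> ratqt symfun \<Rightarrow> ratqt symfun" scale_fls
  by unfold_locales

lemma linear_eqI_power_sum_prod:
  assumes "Vector_Spaces.linear scale scale_fls S" "Vector_Spaces.linear scale scale_fls T"
    and "\<And>\<nu>. \<nu> \<in> partitions \<Longrightarrow> S (power_sum_prod \<nu>) = T (power_sum_prod \<nu>)"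
  shows "S F = T F"
proof (rule symfun_laurent.linear_eq_on[OF assms(1,2)])
  show "F \<in> symfun.span (power_sum_prod ` partitions)" by (simp add: power_sums.span_vec)
qed (use assms(3) in auto)

lemma
  shows linear_plethysm: "Vector_Spaces.linear scale scale_fls (\<lambda>F. plethysm F E)"
    and plethysm_power_sum_prod:
      "\<nu> \<in> partitions \<Longrightarrow> plethysm (power_sum_prod \<nu>) E = (\<Prod>k\<in>#\<nu>. pleth_p k E)"
proof -
  let ?f = "\<lambda>b. \<Prod>k\<in>#inv_into partitions power_sum_prod b. pleth_p k E"
  obtain T where linear_T: "Vector_Spaces.linear scale scale_fls T"
    and T_basis: "\<forall>b \<in> power_sum_prod ` partitions. T b = ?f b"
    using symfun_laurent.linear_independent_extend[OF power_sums.independent_vec, of ?f] by blast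
  have T_power_sum_prod: "T (power_sum_prod \<nu>) = (\<Prod>k\<in>#\<nu>. pleth_p k E)" if "\<nu> \<in> partitions" for \<nu>
    using T_basis that by (simp add: inv_into_f_f[OF power_sums.inj_on_vec])
  have plethysm_eq: "plethysm F E = T F" for F
  proof -
    have "plethysm F E = laurent.combination (\<lambda>\<nu>. T (power_sum_prod \<nu>)) (power_sum_expansion F)"
      unfolding plethysm_def laurent.combination_def
    proof (rule sum.cong)
      fix \<nu> assume "\<nu> \<in> Poly_Mapping.keys (power_sum_expansion F)"
      hence "\<nu> \<in> partitions" using keys_power_sum_expansion by blast
      thus "scale_fls (Poly_Mapping.lookup (power_sum_expansion F) \<nu>) (\<Prod>k\<in>#\<nu>. pleth_p k E) =
          scale_fls (Poly_Mapping.lookup (power_sum_expansion F) \<nu>) (T (power_sum_prod \<nu>))"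
        by (simp only: T_power_sum_prod)
    qed simp
    also have "\<dots> = T (symfun.combination power_sum_prod (power_sum_expansion F))"
      by (rule symfun_laurent.linear_combination[OF linear_T, symmetric])
    finally show ?thesis by (simp only: combination_power_sum_expansion)
  qed
  show "Vector_Spaces.linear scale scale_fls (\<lambda>F. plethysm F E)"
    unfolding plethysm_eq by (rule linear_T)
  show "plethysm (power_sum_prod \<nu>) E = (\<Prod>k\<in>#\<nu>. pleth_p k E)" if "\<nu> \<in> partitions"
    unfolding plethysm_eq using that by (rule T_power_sum_prod)
qed

lemmas plethysm_add = symfun_laurent.linear_add[OF linear_plethysm]
lemmas plethysm_scale = symfun_laurent.linear_scale[OF linear_plethysm]

lemma linear_plethysm_mult_right: "Vector_Spaces.linear scale scale_fls (\<lambda>F. plethysm (F * G) E)"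
  by unfold_locales (simp_all only: distrib_right scale_mult_left plethysm_add plethysm_scale)

lemma linear_mult_plethysm: "Vector_Spaces.linear scale scale_fls (\<lambda>F. plethysm F E * A)"
  by unfold_locales (simp_all only: distrib_right mult.assoc plethysm_add plethysm_scale)

lemma plethysm_mult: "plethysm (F * G) E = plethysm F E * plethysm G E"
proof (rule linear_eqI_power_sum_prod[OF linear_plethysm_mult_right linear_mult_plethysm])
  fix \<nu> assume \<nu>: "\<nu> \<in> partitions"
  have "plethysm (G * power_sum_prod \<nu>) E = plethysm G E * plethysm (power_sum_prod \<nu>) E"
  proof (rule linear_eqI_power_sum_prod[OF linear_plethysm_mult_right linear_mult_plethysm])
    fix \<kappa> assume \<kappa>: "\<kappa> \<in> partitions"
    have "plethysm (power_sum_prod \<kappa> * power_sum_prod \<nu>) E = plethysm (power_sum_prod (\<kappa> + \<nu>)) E"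
      by simp
    also have "\<dots> = (\<Prod>k\<in>#\<kappa> + \<nu>. pleth_p k E)"
      using \<kappa> \<nu> by (intro plethysm_power_sum_prod) simp
    finally show "plethysm (power_sum_prod \<kappa> * power_sum_prod \<nu>) E =
        plethysm (power_sum_prod \<kappa>) E * plethysm (power_sum_prod \<nu>) E"
      using \<kappa> \<nu> by (simp only: plethysm_power_sum_prod image_mset_union prod_mset_Un)
  qed
  thus "plethysm (power_sum_prod \<nu> * G) E = plethysm (power_sum_prod \<nu>) E * plethysm G E"
    by (simp only: mult.commute)
qed

lemma raise_qt_1_left: "raise_qt 1 x = x"
proof -
  have pcompose_monom_1: "pcompose p (monom 1 (Suc 0)) = p" for p :: "'b::comm_ring_1 poly"
    using pcompose_idR[of p] by (simp add: monom_altdef)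
  have "raise_poly 1 p = p" for p by (simp add: raise_poly_def pcompose_monom_1)
  thus ?thesis by (cases x) (simp add: raise_qt_Fract)
qed

lemma raise_sym_1: "raise_sym 1 f = f"
  by (rule symfun_eqI) (simp add: raise_sym.rep_eq raise_qt_1_left[simplified])

lemma pleth_p_1: "pleth_p 1 E = E"
  by (rule fls_eqI) (simp add: pleth_p_def raise_sym_1[simplified] fls_nth_compose_power)

lemma elem_sym_1: "elem_sym 1 = varsum"
proof (rule symfun_eqI)
  fix \<mu> :: "nat multiset"
  show "scoeff (elem_sym 1) \<mu> = scoeff varsum \<mu>"
    unfolding elem_sym.rep_eq varsum.rep_eq using count_le_size[of \<mu>] by auto
qed

lemma plethysm_varsum: "plethysm varsum E = E"
  using plethysm_power_sum_prod[of "{#1#}" E] pleth_p_1 raise_sym_1 by (simp add: power_sum_def)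

section \<open>The operators\<close>

lemma linear_D_op: "Vector_Spaces.linear scale scale (D_op n)"
  by unfold_locales
     (simp_all add: D_op_def plethysm_add plethysm_scale distrib_right mult.assoc const_mult)

lemma commutator_D_op_e1_op: "commutator (D_op n) e1_op F = scale MM (D_op (n + 1) F)"
proof -
  define E where "E = fls_const varsum + fls_const (const MM) * fls_X_inv"
  define A where "A = plethysm F E * fps_to_fls (Omega (- (fls_X * fls_const varsum)))"
  have D_op_eq: "D_op k F = A $$ k" for k by (simp add: D_op_def A_def E_def)
  have "D_op n (e1_op F) = (E * A) $$ n"
    by (simp only: D_op_def e1_op_def elem_sym_1 plethysm_mult plethysm_varsum A_def
        E_def[symmetric] mult.assoc)
  also have "\<dots> = varsum * A $$ n + const MM * A $$ (n + 1)"
    by (simp add: E_def distrib_right mult.assoc fls_X_inv_times_conv_shift(1))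
  finally show ?thesis
    by (simp add: commutator_def D_op_eq e1_op_def elem_sym_1[simplified] const_mult)
qed

lemma MM_nonzero: "MM \<noteq> 0"
  by (simp add: MM_def qq_def tt_def One_fract_def Zero_fract_def eq_fract one_pCons)

lemma Q_op_Split:
  assumes "coprime m n" "m \<ge> 1" "n \<ge> 1" "Split m n = ((a, b), (c, d))"
  shows "Q_op m n = (\<lambda>F. scale (1 / MM) (commutator (Q_op c d) (Q_op a b) F))"
  using assms by (subst Q_op.simps) simp

lemma Q_op_1: "Q_op 1 n = D_op (int n)"
proof (induction n)
  case 0
  show ?case by (simp add: Q_op.simps)
next
  case (Suc n)
  interpret D_op: Vector_Spaces.linear scale scale "D_op (int n)" by (rule linear_D_op)
  show ?case
  proof
    fix F
    have "Q_op 1 (Suc n) F = scale (1 / MM) (commutator (Q_op 0 1) (Q_op 1 n) F)"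
      by (subst Q_op_Split[where a = 1 and b = n and c = 0 and d = 1]) (simp_all add: Split_def)
    also have "commutator (Q_op 0 1) (Q_op 1 n) F = commutator (D_op (int n)) e1_op F"
      by (simp add: Suc[simplified] Q_op.simps[of 0 1, simplified] commutator_def D_op.neg)
    also have "scale (1 / MM) \<dots> = D_op (int (Suc n)) F"
      by (simp add: commutator_D_op_e1_op MM_nonzero add.commute)
    finally show "Q_op 1 (Suc n) F = D_op (int (Suc n)) F" .
  qed
qed

theorem theorem1p4:
  fixes m n :: nat
  assumes "coprime m n" and "m \<ge> 1"
  shows "(m > 1 \<longrightarrow> (\<forall>a b c d. Split m n = ((a, b), (c, d)) \<longrightarrow>
            Q_op m n = (\<lambda>F. scale (1 / MM) (commutator (Q_op c d) (Q_op a b) F))))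
       \<and> (m = 1 \<longrightarrow> Q_op 1 n = D_op (int n))"
proof (intro conjI impI allI)
  fix a b c d
  assume "m > 1" and split: "Split m n = ((a, b), (c, d))"
  hence "n \<ge> 1" using assms(1) by (cases n) auto
  thus "Q_op m n = (\<lambda>F. scale (1 / MM) (commutator (Q_op c d) (Q_op a b) F))"
    using assms split by (intro Q_op_Split)
qed (rule Q_op_1)

end
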